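(* Let $d_{\mathrm v}\ge 3$ and $d_{\mathrm r}\ge 2$ be integers, let $\rho_2,\dots,\rho_{d_{\mathrm r}}\ge 0$ be reals with $\sum_{j=2}^{d_{\mathrm r}}\rho_j=1$, and let $R\in(0,1]$ be the rate of a variable-regular, check-irregular $(d_{\mathrm v},\rho(x))$ binary LDPC code, where $\rho_j$ is the fraction of edges belonging to degree-$j$ check nodes. For $E_{\mathrm b}/N_0>0$ let $m_\lambda=4R\,E_{\mathrm b}/N_0$ and let $(m^{(l)})_{l\ge 0}$ be the sequence of check-node output means predicted by (Gaussian-approximation) density evolution, i.e. $m^{(0)}=0$ and, for $l\ge1$, $$m^{(l)}=\sum_{j=2}^{d_{\mathrm r}}\rho_j\,\phi^{-1}\left(1-\left[1-\phi\left(m_\lambda+(d_{\mathrm v}-1)m^{(l-1)}\right)\right]^{j-1}\right).$$ Then for every $E_{\mathrm b}/N_0$ above the decoding threshold and every real $r$ with $0\le r<d_{\mathrm v}-1$, the sequence $m^{(l)}$ asymptotically dominates $r^l$ after a finite number of iterations. That is, there exist a real $C>0$ and a finite iteration index $L\ge1$ with $$m^{(l)}>C\,r^l\qquad\text{for all } l\ge L.$$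
   Context: Setting: a binary LDPC code whose Tanner graph has all variable nodes of degree $d_{\mathrm v}$ and check nodes of degrees between $2$ and $d_{\mathrm r}$ (the maximum check degree), with edge-perspective check degree distribution $\rho(x)$ having coefficients $\rho_j$; binary antipodal signaling over the additive white Gaussian noise channel; decoding by the log-likelihood-ratio (LLR) domain sum-product algorithm without saturation. The channel quality is $E_{\mathrm b}/N_0$ (a positive real, on a linear scale), $R$ is the code rate, and the mean channel LLR is $m_\lambda=4R\,E_{\mathrm b}/N_0$. "Density evolution" means the consistent Gaussian approximation to density evolution, in which the mean $m^{(l)}$ of the check-node output LLR at iteration $l$ evolves by the recursion in the claim. The decoding threshold is the infimum of those values of $E_{\mathrm b}/N_0>0$ for which the density evolution recursion satisfies $m^{(l)}\to\infty$ as $l\to\infty$. The function $\phi:[0,\infty)\to(0,1]$ is $$\phi(x)=\begin{cases}1-\dfrac{1}{\sqrt{4\pi x}}\displaystyle\int_{\mathbb R}\tanh\frac u2\; e^{-\frac{(u-x)^2}{4x}}\,du,& x>0,\\[2mm] 1,& x=0.\end{cases}$$ It is continuous and strictly decreasing from $1$ (at $x=0$) to $0$ (as $x\to\infty$), and $\phi^{-1}:(0,1]\to[0,\infty)$ is its inverse. *)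

theory Defs
  imports "HOL-Analysis.Analysis"
begin

text \<open>The function \<open>1 - E [tanh (U / 2)]\<close> for a consistent Gaussian \<open>U\<close>, i.e. one with mean \<open>x\<close> and
  variance \<open>2 x\<close>. Only arguments \<open>x \<ge> 0\<close> are meaningful.\<close>

definition ga_phi :: "real \<Rightarrow> real" where
  "ga_phi x =
     (if x > 0
      then 1 - 1 / sqrt (4 * pi * x) * (LBINT u. tanh (u / 2) * exp (- ((u - x)\<^sup>2 / (4 * x))))
      else 1)"

definition ga_phi_inv :: "real \<Rightarrow> real" where
  "ga_phi_inv = inv_into {0..} ga_phi"

definition mean_llr :: "real \<Rightarrow> real \<Rightarrow> real" where
  "mean_llr R ebn0 = 4 * R * ebn0"

text \<open>Mean of the check-node output LLR in iteration \<open>l\<close>; \<open>\<rho> j\<close> (for \<open>2 \<le> j \<le> dr\<close>) is the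
  fraction of edges at check nodes of degree \<open>j\<close>.\<close>

primrec check_mean :: "nat \<Rightarrow> nat \<Rightarrow> (nat \<Rightarrow> real) \<Rightarrow> real \<Rightarrow> nat \<Rightarrow> real" where
  "check_mean dv dr \<rho> mlam 0 = 0"
| "check_mean dv dr \<rho> mlam (Suc l) =
     (\<Sum>j = 2..dr. \<rho> j *
        ga_phi_inv (1 - (1 - ga_phi (mlam + (real dv - 1) * check_mean dv dr \<rho> mlam l)) ^ (j - 1)))"

text \<open>The infimum is taken in the extended reals, so that it is \<open>\<infinity>\<close>, rather than an unspecified
  real, should no channel quality give divergence.\<close>

definition decoding_threshold :: "nat \<Rightarrow> nat \<Rightarrow> (nat \<Rightarrow> real) \<Rightarrow> real \<Rightarrow> ereal" where
  "decoding_threshold dv dr \<rho> R =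
     Inf (ereal ` {ebn0. ebn0 > 0 \<and>
       filterlim (check_mean dv dr \<rho> (mean_llr R ebn0)) at_top sequentially})"

end

theory Submission
  imports Defs "HOL-Probability.Distributions"
begin

text \<open>Tilting the Gaussian density by \<open>1 - tanh (u / 2) = exp (- u / 2) / cosh (u / 2)\<close> centres it
  and gives \<open>\<phi>(x) = exp (- x / 4) E [1 / cosh (sqrt (x / 2) Z)]\<close> with \<open>Z\<close> standard normal. The
  second factor is continuous and decreasing in \<open>x\<close>. Hence \<open>\<phi>\<close> is a decreasing bijection onto
  \<open>(0, 1]\<close>, and \<open>\<phi>(c x) \<ge> exp ((1 - c) x / 4) \<phi>(x)\<close> for \<open>0 \<le> c \<le> 1\<close>. The exponential beats the
  factor at most \<open>dr\<close> lost at a check node, so a large input mean \<open>x\<close> is mapped to at least \<open>c x\<close>;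
  with \<open>c = r / (dv - 1)\<close> each iteration eventually multiplies the mean by at least \<open>r\<close>.
  Monotonicity of the recursion in the channel mean gives divergence above the threshold.\<close>

section \<open>The centred Gaussian factor of \<open>ga_phi\<close>\<close>

definition sech_mean :: "real \<Rightarrow> real" where
  "sech_mean x = (LBINT z. std_normal_density z / cosh (sqrt (x / 2) * z))"

lemma inverse_cosh_le_1: "1 / cosh (a::real) \<le> 1"
  using cosh_real_ge_1[of a] by simp

lemma integrable_sech_mean:
  "integrable lborel (\<lambda>z. std_normal_density z / cosh (a * z))"
proof (rule Bochner_Integration.integrable_bound)
  show "integrable lborel std_normal_density" by simp
  have "(\<lambda>z. cosh (a * z)) \<in> borel_measurable borel"
    by (intro borel_measurable_continuous_onI continuous_intros)
  then show "(\<lambda>z. std_normal_density z / cosh (a * z)) \<in> borel_measurable lborel"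
    by simp
  have "std_normal_density z / cosh (a * z) \<le> std_normal_density z" for z
    using mult_left_mono[OF inverse_cosh_le_1[of "a * z"], of "std_normal_density z"] by simp
  then show "AE z in lborel. norm (std_normal_density z / cosh (a * z)) \<le> norm (std_normal_density z)"
    by simp
qed

lemma sech_mean_0: "sech_mean 0 = 1"
  by (simp add: sech_mean_def)

lemma sech_mean_antimono:
  assumes "0 \<le> x" "x \<le> y"
  shows "sech_mean y \<le> sech_mean x"
  unfolding sech_mean_def
proof (rule integral_mono[OF integrable_sech_mean integrable_sech_mean])
  fix z :: real
  \<comment> \<open>The integrands compare pointwise: \<open>cosh\<close> is even and increases with
    the absolute value of its argument.\<close>
  have "sqrt (x / 2) * \<bar>z\<bar> \<le> sqrt (y / 2) * \<bar>z\<bar>"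
    using assms by (intro mult_right_mono) auto
  then have "cosh \<bar>sqrt (x / 2) * z\<bar> \<le> cosh \<bar>sqrt (y / 2) * z\<bar>"
    using assms by (subst cosh_real_nonneg_le_iff) (simp_all add: abs_mult)
  then have "cosh (sqrt (x / 2) * z) \<le> cosh (sqrt (y / 2) * z)"
    by (simp only: cosh_real_abs)
  then show "std_normal_density z / cosh (sqrt (y / 2) * z)
      \<le> std_normal_density z / cosh (sqrt (x / 2) * z)"
    by (intro divide_left_mono) (auto simp: cosh_real_pos)
qed

lemma sech_mean_pos: "0 < sech_mean x"
proof -
  have "0 < std_normal_density z / cosh (sqrt (x / 2) * z)" for z
    by (intro divide_pos_pos normal_density_pos) auto
  then have nonneg: "0 \<le> std_normal_density z / cosh (sqrt (x / 2) * z)"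
    and nonzero: "std_normal_density z / cosh (sqrt (x / 2) * z) \<noteq> 0" for z
    by (metis less_imp_le, metis less_irrefl)
  \<comment> \<open>A nonnegative integrand with integral zero vanishes almost everywhere; this one
    vanishes nowhere and \<open>lborel\<close> is not the zero measure.\<close>
  have "\<not> (AE z::real in lborel. False)"
    by (simp add: AE_iff_measurable[where N = UNIV])
  then have "sech_mean x \<noteq> 0"
    unfolding sech_mean_def
    by (subst integral_nonneg_eq_0_iff_AE[OF integrable_sech_mean])
       (simp_all only: nonneg nonzero AE_I2 simp_thms)
  moreover have "0 \<le> sech_mean x"
    unfolding sech_mean_def by (intro Bochner_Integration.integral_nonneg nonneg)
  ultimately show ?thesis by simp
qed

text \<open>Dominated convergence with the normal density as majorant. Any \<open>S\<close> is
  allowed because \<open>sqrt\<close> is continuous on all reals, being extended oddly to negative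
  arguments.\<close>

lemma continuous_on_sech_mean: "continuous_on S sech_mean"
  unfolding continuous_on_sequentially
proof (intro allI ballI impI, elim conjE)
  fix X :: "nat \<Rightarrow> real" and x
  assume "X \<longlonglongrightarrow> x"
  have meas: "(\<lambda>z. std_normal_density z / cosh (a * z)) \<in> borel_measurable lborel" for a
    using integrable_sech_mean[of a] by (rule borel_measurable_integrable)
  have "(\<lambda>n. LBINT z. std_normal_density z / cosh (sqrt (X n / 2) * z))
      \<longlonglongrightarrow> (LBINT z. std_normal_density z / cosh (sqrt (x / 2) * z))"
  proof (rule integral_dominated_convergence[where w = std_normal_density])
    show "AE z in lborel. (\<lambda>n. std_normal_density z / cosh (sqrt (X n / 2) * z))
        \<longlonglongrightarrow> std_normal_density z / cosh (sqrt (x / 2) * z)"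
    proof (rule AE_I2)
      fix z :: real
      have "(\<lambda>n. sqrt (X n / 2) * z) \<longlonglongrightarrow> sqrt (x / 2) * z"
        by (intro tendsto_intros \<open>X \<longlonglongrightarrow> x\<close>) auto
      then have "(\<lambda>n. cosh (sqrt (X n / 2) * z)) \<longlonglongrightarrow> cosh (sqrt (x / 2) * z)"
        by (intro isCont_tendsto_compose[where g = cosh] continuous_intros)
      then show "(\<lambda>n. std_normal_density z / cosh (sqrt (X n / 2) * z))
          \<longlonglongrightarrow> std_normal_density z / cosh (sqrt (x / 2) * z)"
        by (intro tendsto_divide tendsto_const) auto
    qed
    show "AE z in lborel. norm (std_normal_density z / cosh (sqrt (X n / 2) * z))
        \<le> std_normal_density z" for n
    proof (rule AE_I2)
      fix z :: real
      show "norm (std_normal_density z / cosh (sqrt (X n / 2) * z)) \<le> std_normal_density z"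
        using mult_left_mono[OF inverse_cosh_le_1, of "std_normal_density z"] by simp
    qed
  qed (use meas in simp_all)
  then show "(sech_mean \<circ> X) \<longlonglongrightarrow> sech_mean x"
    by (simp add: sech_mean_def comp_def)
qed

section \<open>Factorisation of \<open>ga_phi\<close> by exponential tilting\<close>

lemma one_minus_tanh_half: "1 - tanh (u / 2) = exp (- u / 2) / cosh (u / 2)" for u :: real
proof -
  have "cosh (u / 2) - sinh (u / 2) = exp (- (u / 2))"
    by (rule cosh_minus_sinh)
  moreover have "1 - tanh (u / 2) = (cosh (u / 2) - sinh (u / 2)) / cosh (u / 2)"
    by (simp add: tanh_def diff_divide_distrib)
  ultimately show ?thesis by simp
qed

text \<open>Since the variance is twice the mean, the factor \<open>exp (- u / 2)\<close> cancels
  the linear term of the Gaussian exponent: -(u - x)^2 / (4 x) - u / 2 = -u^2 / (4 x) - x / 4.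
  Substituting u = sqrt (2 x) z leaves a standard normal density.\<close>

lemma ga_phi_eq:
  assumes "0 \<le> x"
  shows "ga_phi x = exp (- x / 4) * sech_mean x"
proof (cases "x = 0")
  case True
  then show ?thesis by (simp add: ga_phi_def sech_mean_0)
next
  case False
  with assms have x: "0 < x" by simp
  let ?s = "sqrt (2 * x)"
  let ?g = "normal_density x ?s"
  have s: "0 < ?s" and s2: "?s\<^sup>2 = 2 * x" using x by auto
  have int_g: "integrable lborel ?g" and g1: "(LBINT u. ?g u) = 1"
    using s by simp_all
  have int_gt: "integrable lborel (\<lambda>u. ?g u * tanh (u / 2))"
  proof (rule Bochner_Integration.integrable_bound[OF int_g])
    have "(\<lambda>u::real. tanh (u / 2)) \<in> borel_measurable borel"
      by (intro borel_measurable_continuous_onI continuous_intros) auto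
    then show "(\<lambda>u. ?g u * tanh (u / 2)) \<in> borel_measurable lborel"
      by simp
    have "\<bar>tanh u\<bar> \<le> 1" for u :: real
      using tanh_real_lt_1[of u] tanh_real_gt_neg1[of u] by linarith
    then show "AE u in lborel. norm (?g u * tanh (u / 2)) \<le> norm (?g u)"
      by (auto simp: abs_mult mult_left_le)
  qed
  \<comment> \<open>The shape \<open>0 + ?s * z\<close> is the one produced by
    \<open>lborel_integral_real_affine\<close> with \<open>t = 0\<close>.\<close>
  have tilt: "?g (0 + ?s * z) * (1 - tanh ((0 + ?s * z) / 2)) =
      exp (- x / 4) / ?s * (std_normal_density z / cosh (sqrt (x / 2) * z))" for z
  proof -
    have half: "?s * z / 2 = sqrt (x / 2) * z"
      by (simp add: real_sqrt_divide real_sqrt_mult field_simps)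
    have e: "- (?s * z - x)\<^sup>2 / (2 * ?s\<^sup>2) + - (?s * z) / 2 = - x / 4 + - z\<^sup>2 / 2"
    proof -
      have "(?s * z - x)\<^sup>2 = 2 * x * z\<^sup>2 - 2 * (?s * z) * x + x\<^sup>2"
        using s2 by (simp add: power2_diff power_mult_distrib)
      then show ?thesis
        unfolding s2 using x by (simp add: field_simps power2_eq_square)
    qed
    have exps: "exp (- (?s * z - x)\<^sup>2 / (2 * ?s\<^sup>2)) * exp (- (?s * z) / 2) = exp (- x / 4) * exp (- z\<^sup>2 / 2)"
      unfolding exp_add[symmetric] e ..
    have norm: "sqrt (2 * pi * ?s\<^sup>2) = sqrt (2 * pi) * ?s"
      using x by (simp add: real_sqrt_mult)
    have tanh: "1 - tanh (?s * z / 2) = exp (- (?s * z) / 2) / cosh (sqrt (x / 2) * z)"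
      using one_minus_tanh_half[of "?s * z"] unfolding half .
    have "?g (?s * z) * (1 - tanh (?s * z / 2)) =
        exp (- (?s * z - x)\<^sup>2 / (2 * ?s\<^sup>2)) * exp (- (?s * z) / 2) /
          (sqrt (2 * pi) * ?s * cosh (sqrt (x / 2) * z))"
      unfolding normal_density_def norm tanh
      by (simp only: times_divide_eq_left times_divide_eq_right divide_divide_eq_left mult_1 mult_ac)
    then show ?thesis
      unfolding exps add_0 by (simp add: std_normal_density_def)
  qed
  have "1 / sqrt (4 * pi * x) * (LBINT u. tanh (u / 2) * exp (- ((u - x)\<^sup>2 / (4 * x))))
      = (LBINT u. ?g u * tanh (u / 2))"
    unfolding integral_mult_right_zero[symmetric] normal_density_def s2
    by (simp add: mult_ac)
  then have "ga_phi x = (LBINT u. ?g u) - (LBINT u. ?g u * tanh (u / 2))"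
    using x g1 by (simp add: ga_phi_def)
  also have "\<dots> = (LBINT u. ?g u * (1 - tanh (u / 2)))"
    by (subst Bochner_Integration.integral_diff[OF int_g int_gt, symmetric]) (simp add: algebra_simps)
  also have "\<dots> = ?s * (LBINT z. ?g (0 + ?s * z) * (1 - tanh ((0 + ?s * z) / 2)))"
    using s by (subst lborel_integral_real_affine[where c = ?s and t = 0]) auto
  also have "\<dots> = exp (- x / 4) * sech_mean x"
    unfolding tilt integral_mult_right_zero sech_mean_def using s by simp
  finally show ?thesis .
qed

section \<open>\<open>ga_phi\<close> as a decreasing bijection, and its inverse\<close>

lemma ga_phi_0: "ga_phi 0 = 1"
  by (simp add: ga_phi_def)

lemma ga_phi_pos: "0 \<le> x \<Longrightarrow> 0 < ga_phi x"
  by (simp add: ga_phi_eq sech_mean_pos)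

text \<open>The exponential factors at \<open>x\<close> and \<open>c * x\<close> differ by exactly
  \<open>exp ((1 - c) * x / 4)\<close>, and the factor \<open>sech_mean\<close> is no smaller at
  \<open>c * x\<close>.\<close>

lemma ga_phi_scale:
  assumes "0 \<le> x" "0 \<le> c" "c \<le> 1"
  shows "exp ((1 - c) * x / 4) * ga_phi x \<le> ga_phi (c * x)"
proof -
  have "c * x \<le> x" using assms by (simp add: mult_left_le_one_le)
  then have "exp (- (c * x) / 4) * sech_mean x \<le> exp (- (c * x) / 4) * sech_mean (c * x)"
    using assms by (intro mult_left_mono sech_mean_antimono) auto
  moreover have "exp ((1 - c) * x / 4) * exp (- x / 4) = exp (- (c * x) / 4)"
    unfolding exp_add[symmetric] by (simp add: field_simps)
  ultimately show ?thesis
    using assms by (simp add: ga_phi_eq mult.assoc[symmetric])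
qed

lemma ga_phi_strict_antimono:
  assumes "0 \<le> x" "x < y"
  shows "ga_phi y < ga_phi x"
proof -
  have "ga_phi y = exp (- y / 4) * sech_mean y" using assms by (simp add: ga_phi_eq)
  also have "\<dots> < exp (- x / 4) * sech_mean y"
    using assms sech_mean_pos[of y] by simp
  also have "\<dots> \<le> exp (- x / 4) * sech_mean x"
    using assms by (intro mult_left_mono sech_mean_antimono) auto
  finally show ?thesis using assms by (simp add: ga_phi_eq)
qed

lemma ga_phi_le_iff: "0 \<le> x \<Longrightarrow> 0 \<le> y \<Longrightarrow> ga_phi x \<le> ga_phi y \<longleftrightarrow> y \<le> x"
  using ga_phi_strict_antimono[of x y] ga_phi_strict_antimono[of y x]
  by (cases x y rule: linorder_cases) auto

lemma ga_phi_le_1: "0 \<le> x \<Longrightarrow> ga_phi x \<le> 1"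
  using ga_phi_le_iff[of x 0] by (simp add: ga_phi_0)

lemma ga_phi_surj:
  assumes "0 < y" "y \<le> 1"
  obtains x where "0 \<le> x" "ga_phi x = y"
proof -
  \<comment> \<open>Chosen so that \<open>exp (- b / 4) = y\<close>; as \<open>sech_mean b\<close>
    is at most 1, \<open>ga_phi\<close> has dropped to \<open>y\<close> or below at
    \<open>b\<close>.\<close>
  define b where "b = 4 * ln (1 / y)"
  have b: "0 \<le> b" using assms by (simp add: b_def)
  have "continuous_on {0..b} ga_phi"
    by (rule continuous_on_eq[where f = "\<lambda>x. exp (- x / 4) * sech_mean x"])
       (auto simp: ga_phi_eq intro!: continuous_intros continuous_on_sech_mean)
  moreover have "sech_mean b \<le> 1"
    using sech_mean_antimono[of 0 b] b by (simp add: sech_mean_0)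
  then have "ga_phi b \<le> exp (- b / 4)"
    using b by (simp add: ga_phi_eq)
  then have "ga_phi b \<le> y"
    using assms by (simp add: b_def ln_div)
  ultimately obtain x where "0 \<le> x" "ga_phi x = y"
    using IVT2'[of ga_phi b y 0] assms b by (auto simp: ga_phi_0)
  then show thesis by (rule that)
qed

lemma ga_phi_inv:
  assumes "0 < y" "y \<le> 1"
  shows "0 \<le> ga_phi_inv y" "ga_phi (ga_phi_inv y) = y"
proof -
  have "y \<in> ga_phi ` {0..}"
    using ga_phi_surj[OF assms] by (metis atLeast_iff imageI)
  then show "0 \<le> ga_phi_inv y" "ga_phi (ga_phi_inv y) = y"
    unfolding ga_phi_inv_def using inv_into_into[of y ga_phi "{0..}"]
    by (auto simp: f_inv_into_f)
qed

text \<open>Turns each lower bound on \<open>ga_phi_inv\<close> below into an inequality for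
  \<open>ga_phi\<close> itself.\<close>

lemma le_ga_phi_inv_iff:
  assumes "0 < y" "y \<le> 1" "0 \<le> x"
  shows "x \<le> ga_phi_inv y \<longleftrightarrow> y \<le> ga_phi x"
  using ga_phi_le_iff[of "ga_phi_inv y" x] ga_phi_inv[OF assms(1,2)] assms(3) by simp

section \<open>The update at a single check node, of degree \<open>n + 1\<close>\<close>

definition check_arg :: "nat \<Rightarrow> real \<Rightarrow> real" where
  "check_arg n x = 1 - (1 - ga_phi x) ^ n"

text \<open>Places the argument in (0, 1], where \<open>ga_phi_inv\<close> is a true inverse; at
  \<open>n = 0\<close> it would be 0.\<close>

lemma check_arg_bounds:
  assumes "0 \<le> x" "0 < n"
  shows "0 < check_arg n x" "check_arg n x \<le> 1"
proof -
  have "0 \<le> 1 - ga_phi x" "1 - ga_phi x < 1"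
    using assms ga_phi_pos ga_phi_le_1 by auto
  then show "0 < check_arg n x" "check_arg n x \<le> 1"
    using assms by (auto simp: check_arg_def power_Suc_less_one power_less_one_iff)
qed

lemma check_arg_antimono:
  assumes "0 \<le> x" "x \<le> y"
  shows "check_arg n y \<le> check_arg n x"
  using assms ga_phi_le_iff[of y x] ga_phi_le_1[of x]
  by (auto simp: check_arg_def intro!: power_mono)

text \<open>Bernoulli's inequality: (1 - p)^n is at least 1 - n p.\<close>

lemma check_arg_le:
  assumes "0 \<le> x"
  shows "check_arg n x \<le> real n * ga_phi x"
  using Bernoulli_inequality[of "- ga_phi x" n] ga_phi_le_1[OF assms]
  by (simp add: check_arg_def)

lemma ga_phi_inv_check_arg_mono:
  assumes "0 \<le> x" "x \<le> y" "0 < n"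
  shows "ga_phi_inv (check_arg n x) \<le> ga_phi_inv (check_arg n y)"
proof -
  have bounds: "0 < check_arg n x" "check_arg n x \<le> 1" "0 < check_arg n y" "check_arg n y \<le> 1"
    using assms check_arg_bounds by auto
  then show ?thesis
    using check_arg_antimono[OF assms(1,2), of n]
    by (subst le_ga_phi_inv_iff) (simp_all only: ga_phi_inv)
qed

text \<open>The Bernoulli bound costs a factor \<open>n\<close>, which the exponential gain of
  \<open>ga_phi_scale\<close> absorbs.\<close>

lemma ga_phi_inv_check_arg_ge:
  assumes "0 \<le> x" "0 \<le> c" "c \<le> 1" "0 < n" "real n \<le> exp ((1 - c) * x / 4)"
  shows "c * x \<le> ga_phi_inv (check_arg n x)"
proof -
  have "check_arg n x \<le> real n * ga_phi x" using assms by (intro check_arg_le)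
  also have "\<dots> \<le> exp ((1 - c) * x / 4) * ga_phi x"
    using assms ga_phi_pos[of x] by (intro mult_right_mono) auto
  also have "\<dots> \<le> ga_phi (c * x)" using assms by (intro ga_phi_scale)
  finally show ?thesis
    using assms check_arg_bounds[of x n] by (simp add: le_ga_phi_inv_iff)
qed

section \<open>Monotonicity and growth of the density evolution recursion\<close>

lemma check_mean_Suc:
  "check_mean dv dr \<rho> mlam (Suc l) =
     (\<Sum>j = 2..dr. \<rho> j * ga_phi_inv (check_arg (j - 1) (mlam + (real dv - 1) * check_mean dv dr \<rho> mlam l)))"
  by (simp add: check_arg_def)

declare check_mean.simps(2) [simp del]

lemma check_mean_nonneg:
  assumes "1 \<le> dv" "\<And>j. j \<in> {2..dr} \<Longrightarrow> 0 \<le> \<rho> j" "0 \<le> mlam"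
  shows "0 \<le> check_mean dv dr \<rho> mlam l"
proof (induction l)
  case (Suc l)
  then show ?case
    unfolding check_mean_Suc using assms
    by (intro sum_nonneg mult_nonneg_nonneg ga_phi_inv check_arg_bounds add_nonneg_nonneg) auto
qed simp

lemma check_mean_mono:
  assumes "1 \<le> dv" "\<And>j. j \<in> {2..dr} \<Longrightarrow> 0 \<le> \<rho> j" "0 \<le> a" "a \<le> b"
  shows "check_mean dv dr \<rho> a l \<le> check_mean dv dr \<rho> b l"
proof (induction l)
  case (Suc l)
  have "0 \<le> check_mean dv dr \<rho> a l"
    using assms by (intro check_mean_nonneg)
  with Suc show ?case
    unfolding check_mean_Suc using assms
    by (intro sum_mono mult_left_mono ga_phi_inv_check_arg_mono add_mono add_nonneg_nonneg) auto
qed simp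

text \<open>A value above the infimum exceeds some channel quality that already gives divergence,
  and \<open>check_mean_mono\<close> carries the divergence upwards.\<close>

lemma filterlim_check_mean_above_threshold:
  assumes "1 \<le> dv" "\<And>j. j \<in> {2..dr} \<Longrightarrow> 0 \<le> \<rho> j" "0 < R"
    and "decoding_threshold dv dr \<rho> R < ereal ebn0"
  shows "filterlim (check_mean dv dr \<rho> (mean_llr R ebn0)) at_top sequentially"
proof -
  from assms(4) obtain e where "0 < e" "e < ebn0"
    and lim: "filterlim (check_mean dv dr \<rho> (mean_llr R e)) at_top sequentially"
    by (auto simp: decoding_threshold_def Inf_less_iff)
  then have "check_mean dv dr \<rho> (mean_llr R e) l \<le> check_mean dv dr \<rho> (mean_llr R ebn0) l" for l
    using assms by (intro check_mean_mono) (auto simp: mean_llr_def)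
  then show ?thesis
    by (intro filterlim_at_top_mono[OF lim] always_eventually allI)
qed

text \<open>The weights sum to 1, so a bound common to all summands passes to the average;
  \<open>real dr\<close> dominates every \<open>j - 1\<close>.\<close>

lemma check_mean_Suc_ge:
  fixes dv dr :: nat and \<rho> :: "nat \<Rightarrow> real" and c mlam :: real
  defines "x \<equiv> \<lambda>l. mlam + (real dv - 1) * check_mean dv dr \<rho> mlam l"
  assumes "1 \<le> dv" "\<And>j. j \<in> {2..dr} \<Longrightarrow> 0 \<le> \<rho> j" "(\<Sum>j = 2..dr. \<rho> j) = 1" "0 \<le> mlam"
    and "0 \<le> c" "c \<le> 1" "real dr \<le> exp ((1 - c) * x l / 4)"
  shows "c * x l \<le> check_mean dv dr \<rho> mlam (Suc l)"
proof -
  have "0 \<le> x l"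
    unfolding x_def using assms(2-5)
    by (intro add_nonneg_nonneg mult_nonneg_nonneg check_mean_nonneg) auto
  have "c * x l = (\<Sum>j = 2..dr. \<rho> j * (c * x l))"
    by (simp add: sum_distrib_right[symmetric] assms(4))
  also have "\<dots> \<le> (\<Sum>j = 2..dr. \<rho> j * ga_phi_inv (check_arg (j - 1) (x l)))"
    using assms(3,6-8) \<open>0 \<le> x l\<close>
    by (intro sum_mono mult_left_mono ga_phi_inv_check_arg_ge) auto
  finally show ?thesis
    by (simp add: check_mean_Suc x_def)
qed

lemma eventually_check_mean_Suc_ge:
  assumes "2 \<le> dv" "\<And>j. j \<in> {2..dr} \<Longrightarrow> 0 \<le> \<rho> j" "(\<Sum>j = 2..dr. \<rho> j) = 1" "0 \<le> mlam"
    and "filterlim (check_mean dv dr \<rho> mlam) at_top sequentially"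
    and "0 \<le> r" "r < real dv - 1"
  shows "\<forall>\<^sub>F l in sequentially. r * check_mean dv dr \<rho> mlam l \<le> check_mean dv dr \<rho> mlam (Suc l)"
proof -
  \<comment> \<open>The variable node multiplies the mean by \<open>dv - 1\<close>, so retaining the
    fraction \<open>c < 1\<close> at the check nodes gives total growth \<open>r\<close>.\<close>
  define c where "c = r / (real dv - 1)"
  have dv: "1 \<le> real dv - 1" using assms(1) by simp
  have c: "0 \<le> c" "c < 1" "c * (real dv - 1) = r"
    using assms(6,7) dv by (auto simp: c_def)
  \<comment> \<open>Beyond this bound \<open>exp ((1 - c) * m / 4)\<close> is at least
    \<open>dr + 1\<close> for the mean \<open>m\<close>; the 1 keeps the argument of
    \<open>ln\<close> positive for every \<open>dr\<close>.\<close>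
  have "\<forall>\<^sub>F l in sequentially. 4 * ln (real dr + 1) / (1 - c) \<le> check_mean dv dr \<rho> mlam l"
    using assms(5) by (simp add: filterlim_at_top)
  then show ?thesis
  proof eventually_elim
    case (elim l)
    let ?m = "check_mean dv dr \<rho> mlam l"
    let ?x = "mlam + (real dv - 1) * ?m"
    have m: "0 \<le> ?m" using assms(1-4) by (intro check_mean_nonneg) auto
    have "?m \<le> ?x"
      using mult_right_mono[OF dv m] assms(4) by simp
    then have "(1 - c) * ?m \<le> (1 - c) * ?x"
      using c by (intro mult_left_mono) auto
    moreover have "4 * ln (real dr + 1) \<le> (1 - c) * ?m"
      using elim c by (simp add: field_simps)
    ultimately have "ln (real dr + 1) \<le> (1 - c) * ?x / 4"
      by linarith
    then have "exp (ln (real dr + 1)) \<le> exp ((1 - c) * ?x / 4)"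
      by (simp only: exp_le_cancel_iff)
    then have "c * ?x \<le> check_mean dv dr \<rho> mlam (Suc l)"
      using assms(1-4) c by (intro check_mean_Suc_ge) auto
    moreover have "r * ?m \<le> c * ?x"
      using c assms(4) by (simp add: distrib_left mult.assoc[symmetric])
    ultimately show ?case by simp
  qed
qed

section \<open>From eventual growth by a factor to a geometric lower bound\<close>

lemma geometric_growth:
  fixes f :: "nat \<Rightarrow> real"
  assumes "1 \<le> r" "0 < f L" "\<And>l. L \<le> l \<Longrightarrow> r * f l \<le> f (Suc l)"
  shows "\<exists>C>0. \<forall>l\<ge>L. C * r ^ l < f l"
proof (intro exI conjI allI impI)
  \<comment> \<open>The 2 makes the inequality strict at \<open>l = L\<close>.\<close>
  define C where "C = f L / (2 * r ^ L)"
  show "0 < C" using assms(1,2) by (simp add: C_def)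
  show "C * r ^ l < f l" if "L \<le> l" for l
    using that
  proof (induction l rule: dec_induct)
    case base
    then show ?case using assms(1,2) by (simp add: C_def)
  next
    case (step l)
    have "C * r ^ Suc l = r * (C * r ^ l)" by simp
    also have "\<dots> < r * f l" using step assms(1) by simp
    also have "\<dots> \<le> f (Suc l)" using assms(3) step by simp
    finally show ?case .
  qed
qed

theorem corollary6:
  fixes dv dr :: nat and \<rho> :: "nat \<Rightarrow> real" and R ebn0 r :: real
  assumes "dv \<ge> 3" and "dr \<ge> 2"
    and "\<And>j. j \<in> {2..dr} \<Longrightarrow> \<rho> j \<ge> 0"
    and "(\<Sum>j = 2..dr. \<rho> j) = 1"
    and "0 < R" and "R \<le> 1"
    and "ebn0 > 0"
    and "ereal ebn0 > decoding_threshold dv dr \<rho> R"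
    and "0 \<le> r" and "r < real dv - 1"
  shows "\<exists>C>0. \<exists>L\<ge>1. \<forall>l\<ge>L. check_mean dv dr \<rho> (mean_llr R ebn0) l > C * r ^ l"
proof -
  let ?f = "check_mean dv dr \<rho> (mean_llr R ebn0)"
  \<comment> \<open>\<open>geometric_growth\<close> needs a ratio of at least 1;
    \<open>dv >= 3\<close> keeps \<open>s\<close> below \<open>dv - 1\<close>, and
    \<open>r ^ l\<close> is at most \<open>s ^ l\<close>.\<close>
  define s where "s = max r 1"
  have lim: "filterlim ?f at_top sequentially"
    using assms by (intro filterlim_check_mean_above_threshold) auto
  then have "\<forall>\<^sub>F l in sequentially. 1 \<le> ?f l"
    by (simp add: filterlim_at_top)
  moreover have "\<forall>\<^sub>F l in sequentially. s * ?f l \<le> ?f (Suc l)"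
    using assms lim by (intro eventually_check_mean_Suc_ge) (auto simp: s_def mean_llr_def)
  ultimately have "\<forall>\<^sub>F l in sequentially. 1 \<le> ?f l \<and> s * ?f l \<le> ?f (Suc l)"
    by (rule eventually_conj)
  then obtain N where N: "\<And>l. N \<le> l \<Longrightarrow> 1 \<le> ?f l \<and> s * ?f l \<le> ?f (Suc l)"
    by (auto simp: eventually_sequentially)
  define L where "L = max N 1"
  have "0 < ?f L" using N[of L] by (simp add: L_def)
  then obtain C where C: "0 < C" "\<And>l. L \<le> l \<Longrightarrow> C * s ^ l < ?f l"
    using geometric_growth[of s ?f L] N by (auto simp: s_def L_def)
  have "C * r ^ l < ?f l" if "L \<le> l" for l
  proof -
    have "C * r ^ l \<le> C * s ^ l"
      using assms(9) C(1) by (intro mult_left_mono power_mono) (auto simp: s_def)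
    with C(2)[OF that] show ?thesis by simp
  qed
  then show ?thesis
    using C(1) by (intro exI[of _ C] conjI exI[of _ L]) (auto simp: L_def)
qed

end
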